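(* The upper semi-lattice of Turing degrees is embeddable into the parallel Weihrauch lattice, restricted to total and continuous single-valued functions on Baire space, with an embedding that preserves least upper bounds. That is, there is a map $\iota$ from the set of Turing degrees to the set $\widehat{\mathcal{W}}$ of parallel Weihrauch degrees such that: $a\leq_{\mathrm T}b\iff\iota(a)\leq_{\widehat{\mathrm W}}\iota(b)$ for all Turing degrees $a,b$; each value $\iota(a)$ is the parallel degree of some total continuous single-valued function $f:\mathbb{N}^{\mathbb{N}}\to\mathbb{N}^{\mathbb{N}}$; and $\iota$ maps the least upper bound of any two Turing degrees to the least upper bound of their images in the parallel Weihrauch lattice.
   Context: Turing reducibility for $p,q\in\mathbb{N}^{\mathbb{N}}$: $p\leq_{\mathrm T}q$ iff there is a computable partial $F:\subseteq\mathbb{N}^{\mathbb{N}}\to\mathbb{N}^{\mathbb{N}}$ with $F(q)=p$. Turing degrees are the equivalence classes. A represented space $(X,\delta_X)$ is a set $X$ with a surjective partial map $\delta_X:\subseteq\mathbb{N}^{\mathbb{N}}\to X$; $x\in X$ is computable if it has a computable name. A multi-valued function $f:\subseteq X\rightrightarrows Y$ assigns to each $x$ a set $f(x)\subseteq Y$, with $\mathrm{dom}(f)=\{x: f(x)\neq\emptyset\}$. A realizer of $f$ is a partial $F:\subseteq\mathbb{N}^{\mathbb{N}}\to\mathbb{N}^{\mathbb{N}}$ such that $F(p)$ is defined and $\delta_YF(p)\in f(\delta_X(p))$ for all $p$ with $\delta_X(p)\in\mathrm{dom}(f)$. Baire space $\mathbb{N}^{\mathbb{N}}$ is represented by the identity.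 $\langle\cdot,\cdot\rangle$ is a computable pairing on $\mathbb{N}^{\mathbb{N}}$ and $\langle p_0,p_1,\dots\rangle\langle n,k\rangle=p_n(k)$. $f\leq_{\mathrm W}g$ iff there are computable $H,K:\subseteq\mathbb{N}^{\mathbb{N}}\to\mathbb{N}^{\mathbb{N}}$ such that for every realizer $G$ of $g$ the function $p\mapsto H\langle p,GK(p)\rangle$ is a realizer of $f$. The parallelization of $f:\subseteq X\rightrightarrows Y$ is $\widehat{f}:\subseteq X^{\mathbb{N}}\rightrightarrows Y^{\mathbb{N}}$, $\widehat{f}((x_i)_i)=\prod_{i}f(x_i)$, with $X^{\mathbb{N}}$ represented by $\langle p_0,p_1,\dots\rangle\mapsto(\delta_X(p_i))_i$. $f\leq_{\widehat{\mathrm W}}g$ iff $\widehat{f}\leq_{\mathrm W}\widehat{g}$; equivalence classes are parallel Weihrauch degrees. $\boldsymbol{\emptyset}$ is an extra object with an empty set of realizers (and $\widehat{\boldsymbol\emptyset}=\boldsymbol\emptyset$), to which the reducibilities are extended by the same definition; its degree is $\mathbf{0}$. Fix a set $\mathcal{R}$ of represented spaces that contains $(\mathbb{N}^{\mathbb{N}},\mathrm{id})$ and is closed under products $X\times U$ (represented by $\langle p,q\rangle\mapsto(\delta_X(p),\delta_U(q))$), direct sums $X\oplus U=(\{0\}\times X)\cup(\{1\}\times U)$ (where a name is a first entry, zero for the left and non-zero for the right summand, followed by a name of the element) and countable powers. $\widehat{\mathcal{W}}$ consists of $\mathbf{0}$ and all parallel Weihrauch degrees of multi-valued functions $f:\subseteq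 X\rightrightarrows Y$ with $X,Y\in\mathcal{R}$ and at least one computable point in $\mathrm{dom}(f)$, ordered by $\leq_{\widehat{\mathrm W}}$; this is the parallel Weihrauch lattice. *)

theory Defs
  imports
    "HOL-Analysis.Function_Topology"
    "HOL-Algebra.Order"
    "HOL-Library.Nat_Bijection"
    "HOL-Library.FuncSet"
begin

section \<open>Computability on Baire space\<close>

type_synonym baire = "nat \<Rightarrow> nat"

text \<open>Programs for the partial recursive functions of several arguments relative to an
  oracle \<open>p :: baire\<close>, which \<open>Query\<close> consults.\<close>

datatype program =
    Zero
  | Succ
  | Proj nat
  | Query
  | Comp program "program list"
  | Prec program program
  | Mu program

inductive computes :: "baire \<Rightarrow> program \<Rightarrow> nat list \<Rightarrow> nat \<Rightarrow> bool"
  for p :: baire where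
  zero: "computes p Zero xs 0"
| succ: "computes p Succ [x] (Suc x)"
| proj: "i < length xs \<Longrightarrow> computes p (Proj i) xs (xs ! i)"
| query: "computes p Query [x] (p x)"
| comp: "list_all2 (\<lambda>g y. computes p g xs y) gs ys \<Longrightarrow> computes p f ys z
    \<Longrightarrow> computes p (Comp f gs) xs z"
| prec_0: "computes p f xs y \<Longrightarrow> computes p (Prec f g) (0 # xs) y"
| prec_Suc: "computes p (Prec f g) (n # xs) r \<Longrightarrow> computes p g (n # r # xs) y
    \<Longrightarrow> computes p (Prec f g) (Suc n # xs) y"
| mu: "computes p f (n # xs) 0 \<Longrightarrow> (\<forall>m<n. \<exists>y>0. computes p f (m # xs) y)
    \<Longrightarrow> computes p (Mu f) xs n"

text \<open>One program has to produce \<open>F p\<close> from oracle \<open>p\<close>, for all \<open>p\<close> in the domain of \<open>F\<close>; as is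
  usual in computable analysis, nothing is required outside the domain, so that restrictions of
  computable functions are computable.\<close>

definition computable_fun :: "(baire \<rightharpoonup> baire) \<Rightarrow> bool" where
  "computable_fun F \<longleftrightarrow> (\<exists>e. \<forall>p q. F p = Some q \<longrightarrow> (\<forall>n. computes p e [n] (q n)))"

text \<open>The zero oracle is itself recursive, so this is computability without an oracle.\<close>

definition computable_seq :: "baire \<Rightarrow> bool" where
  "computable_seq p \<longleftrightarrow> (\<exists>e. \<forall>n. computes (\<lambda>_. 0) e [n] (p n))"

definition baire_pair :: "baire \<Rightarrow> baire \<Rightarrow> baire" where
  "baire_pair p q = (\<lambda>n. if even n then p (n div 2) else q (n div 2))"


section \<open>Turing degrees\<close>

definition turing_le :: "baire \<Rightarrow> baire \<Rightarrow> bool" where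
  "turing_le p q \<longleftrightarrow> (\<exists>F. computable_fun F \<and> F q = Some p)"

definition turing_equiv :: "(baire \<times> baire) set" where
  "turing_equiv = {(p, q). turing_le p q \<and> turing_le q p}"

definition turing_degrees :: "baire set gorder" where
  "turing_degrees =
    \<lparr> carrier = UNIV // turing_equiv,
      eq = (=),
      le = (\<lambda>a b. \<exists>p\<in>a. \<exists>q\<in>b. turing_le p q) \<rparr>"


section \<open>Represented spaces\<close>

text \<open>HOL has no sets whose elements range over all types, so the points of all represented spaces
  under consideration are taken from one type. It contains an arbitrary type of atoms and is
  closed under the formation of pairs, tagged elements of direct sums, and sequences.\<close>

datatype 'a point =
    Atom 'a
  | Baire baire
  | Pair "'a point" "'a point"
  | InL "'a point"
  | InR "'a point"
  | Seq "nat \<Rightarrow> 'a point"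

text \<open>Since \<open>\<delta>\<^sub>X\<close> is surjective onto \<open>X\<close>, a represented space \<open>(X, \<delta>\<^sub>X)\<close> is given by the partial
  map \<open>\<delta>\<^sub>X\<close> alone, with \<open>X = ran \<delta>\<^sub>X\<close>.\<close>

type_synonym 'a rep_space = "baire \<rightharpoonup> 'a point"

definition computable_point :: "'a rep_space \<Rightarrow> 'a point \<Rightarrow> bool" where
  "computable_point X x \<longleftrightarrow> (\<exists>p. computable_seq p \<and> X p = Some x)"

definition baire_space :: "'a rep_space" where
  "baire_space = (\<lambda>p. Some (Baire p))"

definition prod_space :: "'a rep_space \<Rightarrow> 'a rep_space \<Rightarrow> 'a rep_space" where
  "prod_space X U = (\<lambda>r. case (X (\<lambda>n. r (2 * n)), U (\<lambda>n. r (2 * n + 1))) of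
      (Some x, Some u) \<Rightarrow> Some (Pair x u)
    | _ \<Rightarrow> None)"

definition sum_space :: "'a rep_space \<Rightarrow> 'a rep_space \<Rightarrow> 'a rep_space" where
  "sum_space X U = (\<lambda>r.
    if r 0 = 0 then map_option InL (X (\<lambda>n. r (Suc n)))
    else map_option InR (U (\<lambda>n. r (Suc n))))"

text \<open>The component \<open>p\<^sub>i\<close> of \<open>r = \<langle>p\<^sub>0, p\<^sub>1, \<dots>\<rangle>\<close>.\<close>

definition baire_component :: "baire \<Rightarrow> nat \<Rightarrow> baire" where
  "baire_component r i = (\<lambda>k. r (prod_encode (i, k)))"

definition power_space :: "'a rep_space \<Rightarrow> 'a rep_space" where
  "power_space X = (\<lambda>r.
    if \<forall>i. baire_component r i \<in> dom X then Some (Seq (\<lambda>i. the (X (baire_component r i))))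
    else None)"

definition admissible_spaces :: "'a rep_space set \<Rightarrow> bool" where
  "admissible_spaces R \<longleftrightarrow>
    baire_space \<in> R \<and>
    (\<forall>X\<in>R. \<forall>U\<in>R. prod_space X U \<in> R) \<and>
    (\<forall>X\<in>R. \<forall>U\<in>R. sum_space X U \<in> R) \<and>
    (\<forall>X\<in>R. power_space X \<in> R)"


section \<open>Multi-valued functions and their realizers\<close>

record 'a mvf =
  src :: "'a rep_space"
  tgt :: "'a rep_space"
  val :: "'a point \<Rightarrow> 'a point set"

definition mvf_dom :: "'a mvf \<Rightarrow> 'a point set" where
  "mvf_dom f = {x. val f x \<noteq> {}}"

definition mvf_between :: "'a rep_space set \<Rightarrow> 'a mvf \<Rightarrow> bool" where
  "mvf_between R f \<longleftrightarrow> src f \<in> R \<and> tgt f \<in> R \<and>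
    mvf_dom f \<subseteq> ran (src f) \<and> (\<forall>x. val f x \<subseteq> ran (tgt f))"

text \<open>\<open>NoRealizer\<close> is the extra object \<open>\<emptyset>\<close>.\<close>

datatype 'a problem = NoRealizer | Mvf "'a mvf"

fun realizer_set :: "'a problem \<Rightarrow> (baire \<rightharpoonup> baire) set" where
  "realizer_set NoRealizer = {}"
| "realizer_set (Mvf f) = {F. \<forall>p x. src f p = Some x \<and> x \<in> mvf_dom f \<longrightarrow>
    (\<exists>q y. F p = Some q \<and> tgt f q = Some y \<and> y \<in> val f x)}"

fun parallelization :: "'a problem \<Rightarrow> 'a problem" where
  "parallelization NoRealizer = NoRealizer"
| "parallelization (Mvf f) = Mvf
    \<lparr> src = power_space (src f),
      tgt = power_space (tgt f),
      val = (\<lambda>x. case x of Seq xs \<Rightarrow> {Seq ys | ys. \<forall>i. ys i \<in> val f (xs i)} | _ \<Rightarrow> {}) \<rparr>"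


section \<open>Parallel Weihrauch degrees\<close>

definition weihrauch_le :: "'a problem \<Rightarrow> 'a problem \<Rightarrow> bool" where
  "weihrauch_le f g \<longleftrightarrow> (\<exists>H K. computable_fun H \<and> computable_fun K \<and>
    (\<forall>G\<in>realizer_set g.
      (\<lambda>p. Option.bind (K p) (\<lambda>k. Option.bind (G k) (\<lambda>q. H (baire_pair p q)))) \<in> realizer_set f))"

definition pw_le :: "'a problem \<Rightarrow> 'a problem \<Rightarrow> bool" where
  "pw_le f g \<longleftrightarrow> weihrauch_le (parallelization f) (parallelization g)"

definition problems :: "'a rep_space set \<Rightarrow> 'a problem set" where
  "problems R = insert NoRealizer {Mvf f | f. mvf_between R f}"

definition pw_degree :: "'a rep_space set \<Rightarrow> 'a problem \<Rightarrow> 'a problem set" where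
  "pw_degree R f = {g \<in> problems R. pw_le f g \<and> pw_le g f}"

definition pw_lattice :: "'a rep_space set \<Rightarrow> 'a problem set gorder" where
  "pw_lattice R =
    \<lparr> carrier = insert (pw_degree R NoRealizer)
        {pw_degree R (Mvf f) | f. mvf_between R f \<and> (\<exists>x\<in>mvf_dom f. computable_point (src f) x)},
      eq = (=),
      le = (\<lambda>a b. \<exists>f\<in>a. \<exists>g\<in>b. pw_le f g) \<rparr>"

text \<open>A total single-valued function on Baire space as a multi-valued function.\<close>

definition baire_fun :: "(baire \<Rightarrow> baire) \<Rightarrow> 'a problem" where
  "baire_fun f = Mvf
    \<lparr> src = baire_space,
      tgt = baire_space,
      val = (\<lambda>x. case x of Baire p \<Rightarrow> {Baire (f p)} | _ \<Rightarrow> {}) \<rparr>"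

end

theory Submission
  imports Defs
begin

text \<open>A Turing degree \<open>a\<close> is sent to the parallel Weihrauch degree of the constant function with
  value some \<open>p \<in> a\<close>. Every name of a solution of the parallelized constant problem is
  the sequence \<open>\<langle>p, p, \<dots>\<rangle>\<close>, so solving it amounts to having \<open>p\<close> as an oracle. A reduction of the constant \<open>p\<close>
  to the constant \<open>q\<close>, applied to the computable instance \<open>0\<close>, computes \<open>p\<close> from
  \<open>\<langle>0, \<langle>q, q, \<dots>\<rangle>\<rangle>\<close> and hence from \<open>q\<close>; conversely, a machine computing \<open>p\<close> from \<open>q\<close> serves as the
  post-processor of a reduction that ignores its input. This is
  \<open>pw_le_const_iff_turing_le\<close>.

  The least upper bound of the degrees of \<open>p\<close> and \<open>q\<close> is that of \<open>baire_pair p q\<close>, which yields an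
  upper bound on the Weihrauch side because the embedding is monotone. For leastness, suppose that
  the constants \<open>p\<close> and \<open>q\<close> both reduce to the parallelization of \<open>h\<close>. The two instances that the
  reductions ask for, each a sequence of instances of \<open>h\<close>, are interleaved into one sequence. One
  call of the parallelization of \<open>h\<close> then returns solutions of both, from which \<open>p\<close> and \<open>q\<close> are
  computed. This is \<open>pw_le_const_pair\<close>, and it is where parallelization is essential: a call
  of \<open>h\<close> alone might not serve two instances. The extra object \<open>NoRealizer\<close> is above everything, so
  as an upper bound it needs no argument.

  Two tools make this precise. Oracle programs compose by replacing queries with a program
  for the oracle (\<open>computes_substitute\<close>), which gives a small calculus of computable functions on
  Baire space. And a reduction between problems is expressed pointwise in terms of names of
  instances and solutions (\<open>weihrauch_le_Mvf_iff\<close>), which removes the quantification over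
  realizers.\<close>

section \<open>A calculus of computable functionals\<close>

text \<open>The domain \<open>D\<close> restricts the oracles, so that partial functionals obey the same closure rules
  as total ones; the number arguments always range over all lists of length \<open>k\<close>.\<close>

definition computable_on :: "baire set \<Rightarrow> nat \<Rightarrow> (baire \<Rightarrow> nat list \<Rightarrow> nat) \<Rightarrow> bool" where
  "computable_on D k \<Phi> \<longleftrightarrow> (\<exists>e. \<forall>p\<in>D. \<forall>xs. length xs = k \<longrightarrow> computes p e xs (\<Phi> p xs))"

lemma computable_onI:
  assumes "\<And>p xs. p \<in> D \<Longrightarrow> length xs = k \<Longrightarrow> computes p e xs (\<Phi> p xs)"
  shows "computable_on D k \<Phi>"
  using assms unfolding computable_on_def by blast

lemma computable_on_cong:
  assumes "computable_on D k \<Phi>"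
    and "\<And>p xs. p \<in> D \<Longrightarrow> length xs = k \<Longrightarrow> \<Phi> p xs = \<Psi> p xs"
  shows "computable_on D k \<Psi>"
  using assms unfolding computable_on_def by metis

lemma computable_on_nth: "i < k \<Longrightarrow> computable_on D k (\<lambda>p xs. xs ! i)"
  by (rule computable_onI[where e = "Proj i"]) (auto intro: computes.proj)

lemma computable_on_comp:
  assumes g: "computable_on D (length fs) g"
    and fs: "\<And>f. f \<in> set fs \<Longrightarrow> computable_on D k f"
  shows "computable_on D k (\<lambda>p xs. g p (map (\<lambda>f. f p xs) fs))"
proof -
  obtain d where d: "\<And>p xs. p \<in> D \<Longrightarrow> length xs = length fs \<Longrightarrow> computes p d xs (g p xs)"
    using g unfolding computable_on_def by blast
  obtain E where E: "\<And>f p xs. f \<in> set fs \<Longrightarrow> p \<in> D \<Longrightarrow> length xs = k \<Longrightarrow>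
      computes p (E f) xs (f p xs)"
    using fs unfolding computable_on_def by metis
  show ?thesis
  proof (rule computable_onI[where e = "Comp d (map E fs)"], rule computes.comp)
    fix p and xs :: "nat list"
    assume "p \<in> D" "length xs = k"
    then show "list_all2 (\<lambda>g y. computes p g xs y) (map E fs) (map (\<lambda>f. f p xs) fs)"
      by (auto simp: list_all2_conv_all_nth intro: E)
    show "computes p d (map (\<lambda>f. f p xs) fs) (g p (map (\<lambda>f. f p xs) fs))"
      by (rule d) (use \<open>p \<in> D\<close> in auto)
  qed
qed

lemma computable_on_comp1:
  assumes "computable_on D 1 (\<lambda>p xs. g p (xs ! 0))" and "computable_on D k f"
  shows "computable_on D k (\<lambda>p xs. g p (f p xs))"
  using computable_on_comp[of D "[f]" "\<lambda>p xs. g p (xs ! 0)" k] assms by simp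

lemma computable_on_comp2:
  assumes "computable_on D 2 (\<lambda>p xs. g p (xs ! 0) (xs ! 1))"
    and "computable_on D k f" and "computable_on D k f'"
  shows "computable_on D k (\<lambda>p xs. g p (f p xs) (f' p xs))"
proof -
  have "computable_on D (length [f, f']) (\<lambda>p xs. g p (xs ! 0) (xs ! 1))"
    using assms(1) by (simp add: numeral_2_eq_2)
  from computable_on_comp[OF this, of k] show ?thesis
    using assms(2,3) by auto
qed

lemma computable_on_Suc:
  assumes "computable_on D k f"
  shows "computable_on D k (\<lambda>p xs. Suc (f p xs))"
proof (rule computable_on_comp1[where g = "\<lambda>p. Suc", OF _ assms],
    rule computable_onI[where e = Succ])
  fix p and xs :: "nat list"
  assume "length xs = 1"
  then obtain x where "xs = [x]" by (auto simp: length_Suc_conv)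
  then show "computes p Succ xs (Suc (xs ! 0))" by (simp add: computes.succ)
qed

lemma computable_on_query:
  assumes "computable_on D k f"
  shows "computable_on D k (\<lambda>p xs. p (f p xs))"
proof (rule computable_on_comp1[where g = "\<lambda>p. p", OF _ assms],
    rule computable_onI[where e = Query])
  fix p and xs :: "nat list"
  assume "length xs = 1"
  then obtain x where "xs = [x]" by (auto simp: length_Suc_conv)
  then show "computes p Query xs (p (xs ! 0))" by (simp add: computes.query)
qed

lemma computable_on_const: "computable_on D k (\<lambda>p xs. c)"
  by (induction c) (auto intro: computable_onI[where e = Zero] computes.zero computable_on_Suc)

lemma computable_on_prec:
  assumes a: "computable_on D k a" and s: "computable_on D (Suc (Suc k)) s"
  shows "computable_on D (Suc k)
    (\<lambda>p xs. rec_nat (a p (tl xs)) (\<lambda>n r. s p (n # r # tl xs)) (xs ! 0))"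
proof -
  obtain d where d: "\<And>p xs. p \<in> D \<Longrightarrow> length xs = k \<Longrightarrow> computes p d xs (a p xs)"
    using a unfolding computable_on_def by blast
  obtain e where e: "\<And>p xs. p \<in> D \<Longrightarrow> length xs = Suc (Suc k) \<Longrightarrow> computes p e xs (s p xs)"
    using s unfolding computable_on_def by blast
  have "computes p (Prec d e) (n # xs) (rec_nat (a p xs) (\<lambda>n r. s p (n # r # xs)) n)"
    if "p \<in> D" "length xs = k" for p xs n
  proof (induction n)
    case 0
    show ?case using that by (auto intro: computes.prec_0 d)
  next
    case (Suc n)
    have "computes p e (n # rec_nat (a p xs) (\<lambda>n r. s p (n # r # xs)) n # xs)
        (rec_nat (a p xs) (\<lambda>n r. s p (n # r # xs)) (Suc n))"
      using e[OF that(1), of "n # rec_nat (a p xs) (\<lambda>n r. s p (n # r # xs)) n # xs"] that by simp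
    with Suc show ?case by (rule computes.prec_Suc)
  qed
  then show ?thesis
    by (intro computable_onI[where e = "Prec d e"]) (auto simp: length_Suc_conv)
qed

lemma computable_on_prec1:
  assumes "computable_on D 2 (\<lambda>p xs. s (xs ! 0) (xs ! 1))"
    and h: "h 0 = c" "\<And>n. h (Suc n) = s n (h n)"
    and "computable_on D k f"
  shows "computable_on D k (\<lambda>p xs. h (f p xs))"
proof (rule computable_on_comp1[where g = "\<lambda>p. h", OF _ assms(4)])
  have "h n = rec_nat c s n" for n
    by (induction n) (auto simp: h)
  then show "computable_on D 1 (\<lambda>p xs. h (xs ! 0))"
    using computable_on_prec[OF computable_on_const[of D 0 c], of "\<lambda>p xs. s (xs ! 0) (xs ! 1)"] assms(1)
    by (simp add: numeral_2_eq_2)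
qed

lemma computable_on_prec2:
  assumes "computable_on D 1 (\<lambda>p xs. a (xs ! 0))"
    and "computable_on D 3 (\<lambda>p xs. s (xs ! 0) (xs ! 1) (xs ! 2))"
    and h: "\<And>y. h 0 y = a y" "\<And>n y. h (Suc n) y = s n (h n y) y"
    and "computable_on D k f" "computable_on D k g"
  shows "computable_on D k (\<lambda>p xs. h (f p xs) (g p xs))"
proof (rule computable_on_comp2[where g = "\<lambda>p. h", OF _ assms(5,6)])
  have h_rec: "h n y = rec_nat (a y) (\<lambda>n r. s n r y) n" for n y
    by (induction n) (auto simp: h)
  have "computable_on D (Suc 1) (\<lambda>p xs. rec_nat (a (tl xs ! 0))
      (\<lambda>n r. s ((n # r # tl xs) ! 0) ((n # r # tl xs) ! 1) ((n # r # tl xs) ! 2)) (xs ! 0))"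
    by (rule computable_on_prec) (use assms(1,2) in \<open>simp_all add: numeral_3_eq_3\<close>)
  then have "computable_on D (Suc 1) (\<lambda>p xs. h (xs ! 0) (xs ! 1))"
    by (rule computable_on_cong) (auto simp: h_rec length_Suc_conv)
  then show "computable_on D 2 (\<lambda>p xs. h (xs ! 0) (xs ! 1))"
    by (simp add: numeral_2_eq_2)
qed

lemma computable_on_add:
  "computable_on D k f \<Longrightarrow> computable_on D k g \<Longrightarrow> computable_on D k (\<lambda>p xs. f p xs + g p xs)"
  by (rule computable_on_prec2[where h = "(+)" and a = "\<lambda>y. y" and s = "\<lambda>n r y. Suc r"])
    (auto intro!: computable_on_Suc computable_on_nth)

lemma computable_on_mult:
  "computable_on D k f \<Longrightarrow> computable_on D k g \<Longrightarrow> computable_on D k (\<lambda>p xs. f p xs * g p xs)"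
  by (rule computable_on_prec2[where h = "(*)" and a = "\<lambda>y. 0" and s = "\<lambda>n r y. y + r"])
    (auto intro!: computable_on_add computable_on_nth computable_on_const)

lemma computable_on_pred: "computable_on D k f \<Longrightarrow> computable_on D k (\<lambda>p xs. f p xs - 1)"
  by (rule computable_on_prec1[where h = "\<lambda>n. n - 1" and s = "\<lambda>n r. n"])
    (auto intro!: computable_on_nth)

lemma computable_on_diff:
  "computable_on D k f \<Longrightarrow> computable_on D k g \<Longrightarrow> computable_on D k (\<lambda>p xs. f p xs - g p xs)"
  by (rule computable_on_prec2[where h = "\<lambda>n y. y - n" and a = "\<lambda>y. y" and s = "\<lambda>n r y. r - 1"])
    (auto intro!: computable_on_pred computable_on_nth simp del: One_nat_def)

lemma computable_on_mod_2: "computable_on D k f \<Longrightarrow> computable_on D k (\<lambda>p xs. f p xs mod 2)"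
  by (rule computable_on_prec1[where h = "\<lambda>n. n mod 2" and s = "\<lambda>n r. 1 - r"])
    (auto intro!: computable_on_diff computable_on_nth computable_on_const simp: mod_Suc)

lemma computable_on_div_2: "computable_on D k f \<Longrightarrow> computable_on D k (\<lambda>p xs. f p xs div 2)"
  by (rule computable_on_prec1[where h = "\<lambda>n. n div 2" and s = "\<lambda>n r. r + n mod 2"])
    (auto intro!: computable_on_add computable_on_mod_2 computable_on_nth simp: div_Suc mod_Suc
      simp flip: numeral_2_eq_2 split: if_splits)

lemma computable_on_triangle:
  "computable_on D k f \<Longrightarrow> computable_on D k (\<lambda>p xs. triangle (f p xs))"
  by (rule computable_on_prec1[where h = triangle and s = "\<lambda>n r. r + Suc n"])
    (auto intro!: computable_on_add computable_on_Suc computable_on_nth)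

lemma computable_on_prod_encode:
  "computable_on D k f \<Longrightarrow> computable_on D k g \<Longrightarrow>
    computable_on D k (\<lambda>p xs. prod_encode (f p xs, g p xs))"
  unfolding prod_encode_def by (auto intro!: computable_on_add computable_on_triangle)

definition decode_sum :: "nat \<Rightarrow> nat" where
  "decode_sum n = fst (prod_decode n) + snd (prod_decode n)"

lemma prod_decode_via_sum:
  "n = triangle (decode_sum n) + fst (prod_decode n)"
  using prod_decode_inverse[of n]
  by (cases "prod_decode n") (simp add: decode_sum_def prod_encode_def)

text \<open>The pair with code \<open>n\<close> lies on the antidiagonal \<open>decode_sum n\<close>, whose first code is the
  triangle number of this sum. The enumeration moves to the next antidiagonal exactly
  when the next code is a triangle number, which makes \<open>decode_sum\<close> primitive recursive
  without encoding pairs in the recursion.\<close>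

lemma decode_sum_Suc:
  "decode_sum (Suc n) = decode_sum n + (1 - (triangle (Suc (decode_sum n)) - Suc n))"
proof -
  obtain i j where ij: "prod_decode n = (i, j)" by force
  have n: "n = prod_encode (i, j)"
    using prod_decode_inverse[of n] by (simp add: ij)
  show ?thesis
  proof (cases j)
    case 0
    then have "Suc n = prod_encode (0, Suc i)"
      by (simp add: n prod_encode_def)
    then have "prod_decode (Suc n) = (0, Suc i)"
      by (metis prod_encode_inverse)
    moreover have "n = triangle i + i"
      using n 0 by (simp add: prod_encode_def)
    ultimately show ?thesis
      using 0 ij by (simp add: decode_sum_def)
  next
    case (Suc j')
    then have "Suc n = prod_encode (Suc i, j')"
      by (simp add: n prod_encode_def)
    then have "prod_decode (Suc n) = (Suc i, j')"
      by (metis prod_encode_inverse)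
    moreover have "n = triangle (i + j) + i"
      using n by (simp add: prod_encode_def)
    ultimately show ?thesis
      using Suc ij by (simp add: decode_sum_def)
  qed
qed

lemma computable_on_decode_sum:
  "computable_on D k f \<Longrightarrow> computable_on D k (\<lambda>p xs. decode_sum (f p xs))"
  by (rule computable_on_prec1[where h = decode_sum
        and s = "\<lambda>n r. r + (1 - (triangle (Suc r) - Suc n))"])
    (auto intro!: computable_on_add computable_on_diff computable_on_triangle computable_on_Suc
      computable_on_nth computable_on_const simp: decode_sum_Suc simp del: triangle_Suc)

lemma computable_on_fst_prod_decode:
  assumes "computable_on D k f"
  shows "computable_on D k (\<lambda>p xs. fst (prod_decode (f p xs)))"
proof -
  have "fst (prod_decode n) = n - triangle (decode_sum n)" for n
    using prod_decode_via_sum[of n] by linarith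
  then show ?thesis
    using assms by (auto intro!: computable_on_diff computable_on_triangle computable_on_decode_sum)
qed

lemma computable_on_snd_prod_decode:
  assumes "computable_on D k f"
  shows "computable_on D k (\<lambda>p xs. snd (prod_decode (f p xs)))"
proof -
  have "snd (prod_decode n) = decode_sum n - fst (prod_decode n)" for n
    by (simp add: decode_sum_def)
  then show ?thesis
    using assms
    by (auto intro!: computable_on_diff computable_on_fst_prod_decode computable_on_decode_sum)
qed

lemmas computable_on_intros =
  computable_on_nth computable_on_const computable_on_Suc computable_on_query computable_on_add
  computable_on_mult computable_on_diff computable_on_mod_2 computable_on_div_2
  computable_on_prod_encode computable_on_fst_prod_decode computable_on_snd_prod_decode

section \<open>Computable functions on Baire space\<close>

lemma computable_fun_iff_computable_on:
  "computable_fun F \<longleftrightarrow> computable_on (dom F) 1 (\<lambda>p xs. the (F p) (xs ! 0))"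
  unfolding computable_fun_def computable_on_def by (fastforce simp: length_Suc_conv dom_def)

lemma computable_fun_reindex:
  assumes "computable_on UNIV 1 (\<lambda>p xs. g (xs ! 0))"
  shows "computable_fun (\<lambda>p. Some (\<lambda>n. p (g n)))"
  unfolding computable_fun_iff_computable_on using computable_on_query[OF assms]
  by (simp add: dom_def)

primrec substitute :: "program \<Rightarrow> program \<Rightarrow> program" where
  "substitute d Zero = Zero"
| "substitute d Succ = Succ"
| "substitute d (Proj i) = Proj i"
| "substitute d Query = d"
| "substitute d (Comp f gs) = Comp (substitute d f) (map (substitute d) gs)"
| "substitute d (Prec f g) = Prec (substitute d f) (substitute d g)"
| "substitute d (Mu f) = Mu (substitute d f)"

text \<open>A query is a call with exactly one argument, so a program for the oracle can take its place
  wherever it occurs, and each derivation of a computation is transformed step by step.\<close>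

lemma computes_substitute:
  assumes "computes q e xs y" and d: "\<And>n. computes p d [n] (q n)"
  shows "computes p (substitute d e) xs y"
  using assms(1)
proof induction
  case (comp xs gs ys f z)
  then show ?case
    by (auto intro!: computes.comp simp: list_all2_conv_all_nth)
next
  case (mu f n xs)
  then show ?case
    by (auto intro!: computes.mu)
qed (auto intro: computes.intros d)

lemma computable_fun_bind:
  assumes "computable_fun F" and "computable_fun G"
  shows "computable_fun (\<lambda>p. Option.bind (F p) G)"
proof -
  obtain d where d: "\<And>p q n. F p = Some q \<Longrightarrow> computes p d [n] (q n)"
    using assms(1) unfolding computable_fun_def by blast
  obtain e where e: "\<And>p q n. G p = Some q \<Longrightarrow> computes p e [n] (q n)"
    using assms(2) unfolding computable_fun_def by blast
  show ?thesis
    unfolding computable_fun_def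
    by (rule exI[of _ "substitute d e"])
      (auto simp: bind_eq_Some_conv intro: computes_substitute[OF e d])
qed

lemma computable_fun_map:
  assumes "computable_fun F" and "computable_fun (\<lambda>p. Some (T p))"
  shows "computable_fun (\<lambda>p. map_option T (F p))"
  using computable_fun_bind[OF assms] by (simp add: map_conv_bind_option comp_def)

definition pair_fun :: "(baire \<rightharpoonup> baire) \<Rightarrow> (baire \<rightharpoonup> baire) \<Rightarrow> (baire \<rightharpoonup> baire)" where
  "pair_fun F G p = Option.bind (F p) (\<lambda>a. map_option (baire_pair a) (G p))"

lemma pair_fun_eq_Some:
  "F p = Some a \<Longrightarrow> G p = Some b \<Longrightarrow> pair_fun F G p = Some (baire_pair a b)"
  by (simp add: pair_fun_def)

lemma computable_fun_pair_fun:
  assumes "computable_fun F" and "computable_fun G"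
  shows "computable_fun (pair_fun F G)"
proof -
  let ?D = "dom (pair_fun F G)"
  have sub: "?D \<subseteq> dom F" "?D \<subseteq> dom G"
    by (auto simp: pair_fun_def bind_eq_Some_conv)
  have F: "computable_on ?D 1 (\<lambda>p xs. the (F p) (xs ! 0))"
    and G: "computable_on ?D 1 (\<lambda>p xs. the (G p) (xs ! 0))"
    using assms sub unfolding computable_fun_iff_computable_on computable_on_def by (meson subsetD)+
  (* The case distinction is made arithmetically: both branches are computed, which is harmless
     because F and G are both defined on the domain of the pair. *)
  have "computable_on ?D 1 (\<lambda>p xs. (1 - xs ! 0 mod 2) * the (F p) (xs ! 0 div 2)
      + xs ! 0 mod 2 * the (G p) (xs ! 0 div 2))"
    by (intro computable_on_intros computable_on_comp1[OF F] computable_on_comp1[OF G]) auto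
  then show ?thesis
    unfolding computable_fun_iff_computable_on
    by (rule computable_on_cong)
      (auto simp: pair_fun_def baire_pair_def bind_eq_Some_conv mod2_eq_if)
qed

definition left_part :: "baire \<Rightarrow> baire" where
  "left_part r = (\<lambda>n. r (2 * n))"

definition right_part :: "baire \<Rightarrow> baire" where
  "right_part r = (\<lambda>n. r (2 * n + 1))"

lemma left_part_pair [simp]: "left_part (baire_pair p q) = p"
  by (simp add: left_part_def baire_pair_def)

lemma right_part_pair [simp]: "right_part (baire_pair p q) = q"
  by (simp add: right_part_def baire_pair_def)

definition diagonal :: "baire \<Rightarrow> baire" where
  "diagonal p = (\<lambda>n. p (snd (prod_decode n)))"

lemma component_diagonal [simp]: "baire_component (diagonal p) i = p"
  by (simp add: baire_component_def diagonal_def)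

lemma baire_component_eqI: "(\<And>i. baire_component r i = baire_component s i) \<Longrightarrow> r = s"
  by (metis (no_types, lifting) baire_component_def ext prod_decode_inverse surj_pair)

definition even_components :: "baire \<Rightarrow> baire" where
  "even_components r = (\<lambda>n. case prod_decode n of (i, k) \<Rightarrow> r (prod_encode (2 * i, k)))"

definition odd_components :: "baire \<Rightarrow> baire" where
  "odd_components r = (\<lambda>n. case prod_decode n of (i, k) \<Rightarrow> r (prod_encode (2 * i + 1, k)))"

text \<open>On \<open>r = baire_pair a b\<close>, the component with index \<open>2 * i\<close> of the result is that of \<open>a\<close> with
  index \<open>i\<close>, and the one with index \<open>2 * i + 1\<close> is that of \<open>b\<close>. Reading the parity of the
  index as the side of the pair turns the interleaving into a single reindexing.\<close>

definition interleave :: "baire \<Rightarrow> baire" where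
  "interleave r = (\<lambda>n. case prod_decode n of (i, k) \<Rightarrow> r (2 * prod_encode (i div 2, k) + i mod 2))"

lemma component_even_components [simp]:
  "baire_component (even_components r) i = baire_component r (2 * i)"
  by (simp add: baire_component_def even_components_def)

lemma component_odd_components [simp]:
  "baire_component (odd_components r) i = baire_component r (2 * i + 1)"
  by (simp add: baire_component_def odd_components_def)

lemma component_interleave:
  "baire_component (interleave (baire_pair a b)) i =
    (if even i then baire_component a (i div 2) else baire_component b (i div 2))"
  by (auto simp: baire_component_def interleave_def baire_pair_def even_iff_mod_2_eq_zero
      odd_iff_mod_2_eq_one)

lemma computable_fun_id: "computable_fun Some"
  using computable_fun_reindex[of "\<lambda>n. n"] by (simp add: computable_on_intros)

lemma computable_fun_zero: "computable_fun (\<lambda>p. Some (\<lambda>n. 0))"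
  by (simp add: computable_fun_iff_computable_on computable_on_const)

lemma computable_fun_left_part: "computable_fun (\<lambda>r. Some (left_part r))"
  unfolding left_part_def by (intro computable_fun_reindex computable_on_intros) simp

lemma computable_fun_right_part: "computable_fun (\<lambda>r. Some (right_part r))"
  unfolding right_part_def by (intro computable_fun_reindex computable_on_intros) simp

lemma computable_fun_diagonal: "computable_fun (\<lambda>r. Some (diagonal r))"
  unfolding diagonal_def by (intro computable_fun_reindex computable_on_intros) simp

lemma computable_fun_component: "computable_fun (\<lambda>r. Some (baire_component r i))"
  unfolding baire_component_def by (intro computable_fun_reindex computable_on_intros) simp

lemma computable_fun_even_components: "computable_fun (\<lambda>r. Some (even_components r))"
  unfolding even_components_def split_beta
  by (intro computable_fun_reindex computable_on_intros) simp_all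

lemma computable_fun_odd_components: "computable_fun (\<lambda>r. Some (odd_components r))"
  unfolding odd_components_def split_beta
  by (intro computable_fun_reindex computable_on_intros) simp_all

lemma computable_fun_interleave: "computable_fun (\<lambda>r. Some (interleave r))"
  unfolding interleave_def split_beta
  by (intro computable_fun_reindex computable_on_intros) simp_all

lemmas computable_fun_intros =
  computable_fun_bind computable_fun_map computable_fun_pair_fun computable_fun_id
  computable_fun_left_part computable_fun_right_part computable_fun_diagonal
  computable_fun_component computable_fun_even_components computable_fun_odd_components
  computable_fun_interleave

section \<open>Turing reducibility\<close>

lemma turing_leI: "computable_fun F \<Longrightarrow> F q = Some p \<Longrightarrow> turing_le p q"
  unfolding turing_le_def by blast

lemma turing_le_refl: "turing_le p p"
  by (rule turing_leI[OF computable_fun_id]) simp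

lemma turing_le_trans:
  assumes "turing_le p q" and "turing_le q r"
  shows "turing_le p r"
proof -
  obtain F G where "computable_fun F" "F q = Some p" "computable_fun G" "G r = Some q"
    using assms unfolding turing_le_def by blast
  then show ?thesis
    using turing_leI[OF computable_fun_bind[of G F], of r p] by simp
qed

lemma turing_le_pair_left: "turing_le p (baire_pair p q)"
  by (rule turing_leI[OF computable_fun_left_part]) simp

lemma turing_le_pair_right: "turing_le q (baire_pair p q)"
  by (rule turing_leI[OF computable_fun_right_part]) simp

lemma turing_le_pair_least:
  assumes "turing_le p r" and "turing_le q r"
  shows "turing_le (baire_pair p q) r"
proof -
  obtain F G where "computable_fun F" "F r = Some p" "computable_fun G" "G r = Some q"
    using assms unfolding turing_le_def by blast
  then show ?thesis
    by (auto intro!: turing_leI[OF computable_fun_pair_fun[of F G]] pair_fun_eq_Some)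
qed

lemma turing_degree_cases:
  assumes "a \<in> carrier turing_degrees"
  obtains p where "a = turing_equiv `` {p}"
  using assms by (auto simp: turing_degrees_def elim: quotientE)

lemma turing_class_in_carrier: "turing_equiv `` {p} \<in> carrier turing_degrees"
  by (simp add: turing_degrees_def quotientI)

lemma turing_degree_le_iff:
  "turing_equiv `` {p} \<sqsubseteq>\<^bsub>turing_degrees\<^esub> turing_equiv `` {q} \<longleftrightarrow> turing_le p q"
  by (auto simp: turing_degrees_def turing_equiv_def intro: turing_le_refl turing_le_trans)

lemma is_lub_iff:
  "is_lub L c {a, b} \<longleftrightarrow> c \<in> carrier L \<and> (a \<in> carrier L \<longrightarrow> a \<sqsubseteq>\<^bsub>L\<^esub> c) \<and> (b \<in> carrier L \<longrightarrow> b \<sqsubseteq>\<^bsub>L\<^esub> c) \<and>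
    (\<forall>d\<in>carrier L. (a \<in> carrier L \<longrightarrow> a \<sqsubseteq>\<^bsub>L\<^esub> d) \<and> (b \<in> carrier L \<longrightarrow> b \<sqsubseteq>\<^bsub>L\<^esub> d) \<longrightarrow> c \<sqsubseteq>\<^bsub>L\<^esub> d)"
  unfolding least_def Upper_def by auto

lemma is_lub_turing_degrees_pair:
  "is_lub turing_degrees (turing_equiv `` {baire_pair p q})
    {turing_equiv `` {p}, turing_equiv `` {q}}"
  by (auto simp: is_lub_iff turing_class_in_carrier turing_degree_le_iff
      intro: turing_le_pair_left turing_le_pair_right turing_le_pair_least elim!: turing_degree_cases)

section \<open>Instances and solutions\<close>

definition instance_name :: "'a mvf \<Rightarrow> baire \<Rightarrow> bool" where
  "instance_name f k \<longleftrightarrow> (\<exists>x. src f k = Some x \<and> x \<in> mvf_dom f)"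

definition solution_name :: "'a mvf \<Rightarrow> baire \<Rightarrow> baire \<Rightarrow> bool" where
  "solution_name f k y \<longleftrightarrow> (\<exists>x z. src f k = Some x \<and> tgt f y = Some z \<and> z \<in> val f x)"

definition solvable :: "'a mvf \<Rightarrow> bool" where
  "solvable f \<longleftrightarrow> (\<forall>k. instance_name f k \<longrightarrow> (\<exists>y. solution_name f k y))"

text \<open>A value outside the target space has no name, so an instance all of whose values lie outside
  has a solution but no named one.\<close>

lemma mvf_between_solvable: "mvf_between R f \<Longrightarrow> solvable f"
  unfolding mvf_between_def solvable_def instance_name_def solution_name_def mvf_dom_def ran_def
  by blast

lemma realizer_set_Mvf_iff:
  "F \<in> realizer_set (Mvf f) \<longleftrightarrow>
    (\<forall>k. instance_name f k \<longrightarrow> (\<exists>y. F k = Some y \<and> solution_name f k y))"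
  by (fastforce simp: instance_name_def solution_name_def)

text \<open>Realizers can be altered at any single name to any permitted answer. Hence the outer
  reduction has to cope with every solution, and an instance of \<open>f\<close> can only be sent to an instance
  of \<open>g\<close>, since elsewhere a realizer may be undefined. Some realizer to alter must exist,
  for which the solvability assumption is made.\<close>

lemma weihrauch_le_Mvf_iff:
  assumes "solvable g"
  shows "weihrauch_le (Mvf f) (Mvf g) \<longleftrightarrow>
    (\<exists>H K. computable_fun H \<and> computable_fun K \<and>
      (\<forall>x. instance_name f x \<longrightarrow> (\<exists>k. K x = Some k \<and> instance_name g k \<and>
        (\<forall>y. solution_name g k y \<longrightarrow> (\<exists>r. H (baire_pair x y) = Some r \<and> solution_name f x r)))))"
    (is "?L \<longleftrightarrow> ?R")
proof
  assume ?L
  then obtain H K where comp: "computable_fun H" "computable_fun K"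
    and red: "\<And>G x. G \<in> realizer_set (Mvf g) \<Longrightarrow> instance_name f x \<Longrightarrow>
      \<exists>r. Option.bind (K x) (\<lambda>k. Option.bind (G k) (\<lambda>q. H (baire_pair x q))) = Some r
        \<and> solution_name f x r"
    unfolding weihrauch_le_def realizer_set_Mvf_iff[of _ f] by blast
  define G0 where "G0 k = (if instance_name g k then Some (SOME y. solution_name g k y) else None)"
    for k
  have G0: "G0 \<in> realizer_set (Mvf g)"
    unfolding realizer_set_Mvf_iff using assms by (simp add: G0_def solvable_def some_eq_ex)
  have "\<exists>k. K x = Some k \<and> instance_name g k \<and>
      (\<forall>y. solution_name g k y \<longrightarrow> (\<exists>r. H (baire_pair x y) = Some r \<and> solution_name f x r))"
    if x: "instance_name f x" for x
  proof -
    obtain k where k: "K x = Some k" and "G0 k \<noteq> None"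
      using red[OF G0 x] by (auto simp: bind_eq_Some_conv)
    then have inst: "instance_name g k"
      by (auto simp: G0_def split: if_splits)
    have "\<exists>r. H (baire_pair x y) = Some r \<and> solution_name f x r" if y: "solution_name g k y" for y
    proof -
      have "G0(k \<mapsto> y) \<in> realizer_set (Mvf g)"
        using G0 y unfolding realizer_set_Mvf_iff by auto
      from red[OF this x] show ?thesis
        by (simp add: k)
    qed
    with k inst show ?thesis by blast
  qed
  with comp show ?R by blast
next
  assume ?R
  then obtain H K where comp: "computable_fun H" "computable_fun K"
    and red: "\<And>x. instance_name f x \<Longrightarrow> \<exists>k. K x = Some k \<and> instance_name g k \<and>
        (\<forall>y. solution_name g k y \<longrightarrow> (\<exists>r. H (baire_pair x y) = Some r \<and> solution_name f x r))"
    by blast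
  have "(\<lambda>p. Option.bind (K p) (\<lambda>k. Option.bind (G k) (\<lambda>q. H (baire_pair p q)))) \<in> realizer_set (Mvf f)"
    if "G \<in> realizer_set (Mvf g)" for G
    using that red unfolding realizer_set_Mvf_iff by fastforce
  with comp show ?L
    unfolding weihrauch_le_def by blast
qed

lemma weihrauch_le_refl: "weihrauch_le f f"
  unfolding weihrauch_le_def
  by (rule exI[of _ "\<lambda>r. Some (right_part r)"], rule exI[of _ Some])
    (simp add: computable_fun_right_part computable_fun_id)

lemma weihrauch_le_trans:
  assumes "weihrauch_le f g" and "weihrauch_le g h"
  shows "weihrauch_le f h"
proof -
  obtain H1 K1 where 1: "computable_fun H1" "computable_fun K1"
    and red1: "\<And>G. G \<in> realizer_set g \<Longrightarrow>
      (\<lambda>p. Option.bind (K1 p) (\<lambda>k. Option.bind (G k) (\<lambda>q. H1 (baire_pair p q)))) \<in> realizer_set f"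
    using assms(1) unfolding weihrauch_le_def by blast
  obtain H2 K2 where 2: "computable_fun H2" "computable_fun K2"
    and red2: "\<And>G. G \<in> realizer_set h \<Longrightarrow>
      (\<lambda>p. Option.bind (K2 p) (\<lambda>k. Option.bind (G k) (\<lambda>q. H2 (baire_pair p q)))) \<in> realizer_set g"
    using assms(2) unfolding weihrauch_le_def by blast
  let ?K = "\<lambda>p. Option.bind (K1 p) K2"
  (* From <p, q> the outer map recomputes the inner instance K1 p, which H2 needs next to q. *)
  let ?H2 = "\<lambda>r. Option.bind
    (pair_fun (\<lambda>r. Option.bind (Some (left_part r)) K1) (\<lambda>r. Some (right_part r)) r) H2"
  let ?H = "\<lambda>r. Option.bind (pair_fun (\<lambda>r. Some (left_part r)) ?H2 r) H1"
  have comp: "computable_fun ?H" "computable_fun ?K"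
    by (intro computable_fun_intros 1 2)+
  have "(\<lambda>p. Option.bind (?K p) (\<lambda>k. Option.bind (G k) (\<lambda>q. ?H (baire_pair p q)))) \<in> realizer_set f"
    if "G \<in> realizer_set h" for G
  proof -
    have "(\<lambda>p. Option.bind (?K p) (\<lambda>k. Option.bind (G k) (\<lambda>q. ?H (baire_pair p q)))) =
      (\<lambda>p. Option.bind (K1 p) (\<lambda>k. Option.bind
        (Option.bind (K2 k) (\<lambda>k'. Option.bind (G k') (\<lambda>q. H2 (baire_pair k q))))
        (\<lambda>q. H1 (baire_pair p q))))"
    proof
      fix p
      show "Option.bind (?K p) (\<lambda>k. Option.bind (G k) (\<lambda>q. ?H (baire_pair p q))) =
        Option.bind (K1 p) (\<lambda>k. Option.bind
          (Option.bind (K2 k) (\<lambda>k'. Option.bind (G k') (\<lambda>q. H2 (baire_pair k q))))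
          (\<lambda>q. H1 (baire_pair p q)))"
        by (cases "K1 p") (auto simp: pair_fun_def map_conv_bind_option)
    qed
    then show ?thesis
      using red1[OF red2[OF that]] by simp
  qed
  with comp show ?thesis
    unfolding weihrauch_le_def by blast
qed

lemma pw_le_refl: "pw_le f f"
  by (simp add: pw_le_def weihrauch_le_refl)

lemma pw_le_trans: "pw_le f g \<Longrightarrow> pw_le g h \<Longrightarrow> pw_le f h"
  unfolding pw_le_def by (rule weihrauch_le_trans)

text \<open>A reduction is a condition on each realizer of its target, and here there are none.\<close>

lemma pw_le_NoRealizer: "pw_le f NoRealizer"
  unfolding pw_le_def weihrauch_le_def using computable_fun_id by auto

section \<open>Parallelization\<close>

definition parallel_mvf :: "'a mvf \<Rightarrow> 'a mvf" where
  "parallel_mvf f = \<lparr> src = power_space (src f), tgt = power_space (tgt f),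
    val = (\<lambda>x. case x of Seq xs \<Rightarrow> {Seq ys | ys. \<forall>i. ys i \<in> val f (xs i)} | _ \<Rightarrow> {}) \<rparr>"

lemma parallelization_Mvf: "parallelization (Mvf f) = Mvf (parallel_mvf f)"
  by (simp add: parallel_mvf_def)

lemma power_space_eq_Some_iff:
  "power_space X r = Some w \<longleftrightarrow> (\<exists>xs. w = Seq xs \<and> (\<forall>i. X (baire_component r i) = Some (xs i)))"
proof
  assume "power_space X r = Some w"
  then have "w = Seq (\<lambda>i. the (X (baire_component r i)))" "\<forall>i. baire_component r i \<in> dom X"
    unfolding power_space_def by (metis option.distinct(1) option.sel)+
  then show "\<exists>xs. w = Seq xs \<and> (\<forall>i. X (baire_component r i) = Some (xs i))"
    by (metis domD option.sel)
qed (auto simp: power_space_def domIff)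

lemma ex_power_space_iff:
  "(\<exists>w. power_space X r = Some w \<and> P w) \<longleftrightarrow>
    (\<exists>xs. (\<forall>i. X (baire_component r i) = Some (xs i)) \<and> P (Seq xs))"
  unfolding power_space_eq_Some_iff by blast

lemma mvf_dom_parallel: "Seq xs \<in> mvf_dom (parallel_mvf f) \<longleftrightarrow> (\<forall>i. xs i \<in> mvf_dom f)"
proof -
  have "Seq xs \<in> mvf_dom (parallel_mvf f) \<longleftrightarrow> (\<exists>ys. \<forall>i. ys i \<in> val f (xs i))"
    by (auto simp: parallel_mvf_def mvf_dom_def)
  also have "\<dots> \<longleftrightarrow> (\<forall>i. \<exists>y. y \<in> val f (xs i))"
    by metis
  finally show ?thesis
    by (auto simp: mvf_dom_def)
qed

lemma instance_name_parallel:
  "instance_name (parallel_mvf f) k \<longleftrightarrow> (\<forall>i. instance_name f (baire_component k i))"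
proof -
  have src: "src (parallel_mvf f) = power_space (src f)"
    by (simp add: parallel_mvf_def)
  have "instance_name (parallel_mvf f) k \<longleftrightarrow>
      (\<exists>xs. \<forall>i. src f (baire_component k i) = Some (xs i) \<and> xs i \<in> mvf_dom f)"
    by (simp add: instance_name_def src ex_power_space_iff mvf_dom_parallel all_conj_distrib)
  also have "\<dots> \<longleftrightarrow> (\<forall>i. \<exists>x. src f (baire_component k i) = Some x \<and> x \<in> mvf_dom f)"
    by metis
  finally show ?thesis
    by (simp add: instance_name_def)
qed

lemma solution_name_parallel:
  "solution_name (parallel_mvf f) k y \<longleftrightarrow>
    (\<forall>i. solution_name f (baire_component k i) (baire_component y i))"
proof -
  have "solution_name (parallel_mvf f) k y \<longleftrightarrow>
      (\<exists>xs zs. \<forall>i. src f (baire_component k i) = Some (xs i) \<and>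
        tgt f (baire_component y i) = Some (zs i) \<and> zs i \<in> val f (xs i))"
    by (simp add: solution_name_def parallel_mvf_def ex_power_space_iff all_conj_distrib)
  also have "\<dots> \<longleftrightarrow> (\<forall>i. \<exists>x z. src f (baire_component k i) = Some x \<and>
        tgt f (baire_component y i) = Some z \<and> z \<in> val f x)"
    by metis
  finally show ?thesis
    by (simp add: solution_name_def)
qed

lemma parallel_mvf_solvable:
  assumes "solvable f"
  shows "solvable (parallel_mvf f)"
  unfolding solvable_def
proof (intro allI impI)
  fix k
  assume k: "instance_name (parallel_mvf f) k"
  have "\<forall>i. \<exists>y. solution_name f (baire_component k i) y"
    using assms k by (simp add: instance_name_parallel solvable_def)
  then obtain ys where "\<And>i. solution_name f (baire_component k i) (ys i)"
    by metis
  then show "\<exists>y. solution_name (parallel_mvf f) k y"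
    unfolding solution_name_parallel
    by (intro exI[of _ "\<lambda>n. case prod_decode n of (i, j) \<Rightarrow> ys i j"]) (simp add: baire_component_def)
qed

lemma instance_name_interleave:
  assumes "instance_name (parallel_mvf f) a" and "instance_name (parallel_mvf f) b"
  shows "instance_name (parallel_mvf f) (interleave (baire_pair a b))"
  using assms by (simp add: instance_name_parallel component_interleave)

lemma solution_name_interleave:
  assumes "solution_name (parallel_mvf f) (interleave (baire_pair a b)) y"
  shows "solution_name (parallel_mvf f) a (even_components y)"
    and "solution_name (parallel_mvf f) b (odd_components y)"
proof -
  have y: "solution_name f (baire_component (interleave (baire_pair a b)) j) (baire_component y j)" for j
    using assms by (simp add: solution_name_parallel)
  show "solution_name (parallel_mvf f) a (even_components y)"
    unfolding solution_name_parallel using y[of "2 * i" for i] by (simp add: component_interleave)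
  show "solution_name (parallel_mvf f) b (odd_components y)"
    unfolding solution_name_parallel using y[of "2 * i + 1" for i] by (simp add: component_interleave)
qed

section \<open>Constant functions\<close>

definition const_mvf :: "baire \<Rightarrow> 'a mvf" where
  "const_mvf p = \<lparr> src = baire_space, tgt = baire_space,
    val = (\<lambda>x. case x of Baire _ \<Rightarrow> {Baire p} | _ \<Rightarrow> {}) \<rparr>"

lemma baire_fun_const: "baire_fun (\<lambda>_. p) = Mvf (const_mvf p)"
  by (simp add: baire_fun_def const_mvf_def)

lemma mvf_dom_const: "mvf_dom (const_mvf p) = range Baire"
proof (rule Set.set_eqI)
  show "x \<in> mvf_dom (const_mvf p) \<longleftrightarrow> x \<in> range Baire" for x
    by (cases x) (auto simp: mvf_dom_def const_mvf_def)
qed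

lemma instance_name_const: "instance_name (parallel_mvf (const_mvf p :: 'a mvf)) k"
proof -
  have "instance_name (const_mvf p :: 'a mvf) k" for k
    unfolding instance_name_def mvf_dom_const by (simp add: const_mvf_def baire_space_def)
  then show ?thesis
    by (simp add: instance_name_parallel)
qed

lemma solution_name_const:
  "solution_name (parallel_mvf (const_mvf p :: 'a mvf)) k y \<longleftrightarrow> y = diagonal p"
proof -
  have "solution_name (const_mvf p :: 'a mvf) k y \<longleftrightarrow> y = p" for k y
    by (auto simp: solution_name_def const_mvf_def baire_space_def)
  then show ?thesis
    by (auto simp: solution_name_parallel intro: baire_component_eqI)
qed

text \<open>The outer reduction \<open>H\<close> may return \<open>p\<close> itself instead of the sequence \<open>\<langle>p, p, \<dots>\<rangle>\<close> that names
  the solution: each of the two is computable from the other, by \<open>diagonal\<close> and by taking a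
  component.\<close>

lemma pw_le_const_iff:
  fixes g :: "'a mvf"
  assumes "solvable g"
  shows "pw_le (Mvf (const_mvf p)) (Mvf g) \<longleftrightarrow>
    (\<exists>H K. computable_fun H \<and> computable_fun K \<and>
      (\<forall>x. \<exists>k. K x = Some k \<and> instance_name (parallel_mvf g) k \<and>
        (\<forall>y. solution_name (parallel_mvf g) k y \<longrightarrow> H (baire_pair x y) = Some p)))"
proof -
  define produces where "produces H K v \<longleftrightarrow>
    (\<forall>x. \<exists>k. K x = Some k \<and> instance_name (parallel_mvf g) k \<and>
      (\<forall>y. solution_name (parallel_mvf g) k y \<longrightarrow> H (baire_pair x y) = Some v))"
    for H K :: "baire \<rightharpoonup> baire" and v
  define obtainable where "obtainable v \<longleftrightarrow>
    (\<exists>H K. computable_fun H \<and> computable_fun K \<and> produces H K v)" for v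
  (* The inner reduction can be kept when H is post-composed with a computable map. *)
  have map: "obtainable (T v)" if T: "computable_fun (\<lambda>v. Some (T v))" and "obtainable v" for T v
  proof -
    obtain H K where HK: "computable_fun H" "computable_fun K" "produces H K v"
      using \<open>obtainable v\<close> unfolding obtainable_def by blast
    have "produces (\<lambda>r. map_option T (H r)) K (T v)"
      unfolding produces_def
    proof
      fix x
      obtain k where "K x = Some k" "instance_name (parallel_mvf g) k"
        "\<And>y. solution_name (parallel_mvf g) k y \<Longrightarrow> H (baire_pair x y) = Some v"
        using HK(3)[unfolded produces_def, rule_format, of x] by auto
      then show "\<exists>k. K x = Some k \<and> instance_name (parallel_mvf g) k \<and>
        (\<forall>y. solution_name (parallel_mvf g) k y \<longrightarrow> map_option T (H (baire_pair x y)) = Some (T v))"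
        by simp
    qed
    then show ?thesis
      unfolding obtainable_def
      by (intro exI conjI) (rule computable_fun_map[OF HK(1) T], rule HK(2))
  qed
  have "pw_le (Mvf (const_mvf p)) (Mvf g) \<longleftrightarrow> obtainable (diagonal p)"
    unfolding pw_le_def parallelization_Mvf weihrauch_le_Mvf_iff[OF parallel_mvf_solvable[OF assms]]
    by (simp add: obtainable_def produces_def instance_name_const solution_name_const)
  also have "\<dots> \<longleftrightarrow> obtainable p"
  proof
    show "obtainable p" if "obtainable (diagonal p)"
      using map[OF computable_fun_component that, of 0] by simp
    show "obtainable (diagonal p)" if "obtainable p"
      by (rule map[OF computable_fun_diagonal that])
  qed
  finally show ?thesis
    by (simp add: obtainable_def produces_def)
qed

lemma const_mvf_solvable: "solvable (const_mvf p :: 'a mvf)"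
proof -
  have "solution_name (const_mvf p :: 'a mvf) k p" for k
    by (simp add: solution_name_def const_mvf_def baire_space_def)
  then show ?thesis
    unfolding solvable_def by blast
qed

text \<open>A reduction has to succeed on every input, in particular on the zero sequence. As this input is
  computable, it can be supplied without an oracle.\<close>

theorem pw_le_const_iff_turing_le:
  "pw_le (Mvf (const_mvf p) :: 'a problem) (Mvf (const_mvf q)) \<longleftrightarrow> turing_le p q" (is "?L \<longleftrightarrow> _")
proof -
  have L: "?L \<longleftrightarrow> (\<exists>H K. computable_fun H \<and> computable_fun K \<and>
      (\<forall>x. K x \<noteq> None \<and> H (baire_pair x (diagonal q)) = Some p))"
    unfolding pw_le_const_iff[OF const_mvf_solvable]
    by (simp add: instance_name_const solution_name_const)
  show ?thesis
  proof
    assume ?L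
    then obtain H K where "computable_fun H" "computable_fun K"
      and red: "\<forall>x. K x \<noteq> None \<and> H (baire_pair x (diagonal q)) = Some p"
      unfolding L by (elim exE conjE)
    then have H: "computable_fun H" "H (baire_pair (\<lambda>n. 0) (diagonal q)) = Some p"
      by simp_all
    let ?F = "\<lambda>q. Option.bind (pair_fun (\<lambda>q. Some (\<lambda>n. 0)) (\<lambda>q. Some (diagonal q)) q) H"
    have "computable_fun ?F"
      by (intro computable_fun_bind computable_fun_pair_fun computable_fun_zero
          computable_fun_diagonal H(1))
    moreover have "?F q = Some p"
      unfolding pair_fun_def using H(2) by simp
    ultimately show "turing_le p q"
      by (rule turing_leI[where F = ?F])
  next
    assume "turing_le p q"
    then obtain F where F: "computable_fun F" "F q = Some p"
      unfolding turing_le_def by blast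
    let ?H = "\<lambda>r. Option.bind (map_option (\<lambda>s. baire_component s 0) (Some (right_part r))) F"
    have "computable_fun ?H"
      by (intro computable_fun_intros F)
    moreover have "?H (baire_pair x (diagonal q)) = Some p" for x
      by (simp add: F)
    ultimately show ?L
      unfolding L using computable_fun_id by - (rule exI[of _ ?H], rule exI[of _ Some], simp)
  qed
qed

text \<open>Both reductions are run on the same input \<open>x\<close>. Interleaving their inner instances gives a single
  instance of the parallelization of \<open>h\<close>, and the even and odd components of any solution of it are
  solutions of the two, as \<open>solution_name_interleave\<close> states.\<close>

theorem pw_le_const_pair:
  fixes h :: "'a problem"
  assumes "h \<in> problems R"
    and p: "pw_le (Mvf (const_mvf p)) h" and q: "pw_le (Mvf (const_mvf q)) h"
  shows "pw_le (Mvf (const_mvf (baire_pair p q))) h"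
proof (cases h)
  case NoRealizer
  then show ?thesis by (simp add: pw_le_NoRealizer)
next
  case (Mvf g)
  have "solvable g"
    using assms(1) by (auto simp: Mvf problems_def intro: mvf_between_solvable)
  note const_iff = pw_le_const_iff[OF this]
  obtain H1 K1 where 1: "computable_fun H1" "computable_fun K1"
    and red1: "\<forall>x. \<exists>k. K1 x = Some k \<and> instance_name (parallel_mvf g) k \<and>
      (\<forall>y. solution_name (parallel_mvf g) k y \<longrightarrow> H1 (baire_pair x y) = Some p)"
    using p unfolding Mvf const_iff by (elim exE conjE)
  obtain H2 K2 where 2: "computable_fun H2" "computable_fun K2"
    and red2: "\<forall>x. \<exists>k. K2 x = Some k \<and> instance_name (parallel_mvf g) k \<and>
      (\<forall>y. solution_name (parallel_mvf g) k y \<longrightarrow> H2 (baire_pair x y) = Some q)"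
    using q unfolding Mvf const_iff by (elim exE conjE)
  let ?K = "\<lambda>x. map_option interleave (pair_fun K1 K2 x)"
  let ?side = "\<lambda>H T r. Option.bind (pair_fun (\<lambda>r. Some (left_part r))
    (\<lambda>r. map_option T (Some (right_part r))) r) H"
  let ?H = "pair_fun (?side H1 even_components) (?side H2 odd_components)"
  have "computable_fun ?K" "computable_fun ?H"
    by (intro computable_fun_intros 1 2)+
  moreover have "\<exists>k. ?K x = Some k \<and> instance_name (parallel_mvf g) k \<and>
      (\<forall>y. solution_name (parallel_mvf g) k y \<longrightarrow> ?H (baire_pair x y) = Some (baire_pair p q))" for x
  proof -
    obtain k1 where k1: "K1 x = Some k1" "instance_name (parallel_mvf g) k1"
      "\<And>y. solution_name (parallel_mvf g) k1 y \<Longrightarrow> H1 (baire_pair x y) = Some p"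
      using red1[rule_format, of x] by auto
    obtain k2 where k2: "K2 x = Some k2" "instance_name (parallel_mvf g) k2"
      "\<And>y. solution_name (parallel_mvf g) k2 y \<Longrightarrow> H2 (baire_pair x y) = Some q"
      using red2[rule_format, of x] by auto
    have "?H (baire_pair x y) = Some (baire_pair p q)"
      if "solution_name (parallel_mvf g) (interleave (baire_pair k1 k2)) y" for y
      using k1(3) k2(3) solution_name_interleave[OF that] by (simp add: pair_fun_def)
    then show ?thesis
      using k1 k2 instance_name_interleave by (simp add: pair_fun_def)
  qed
  ultimately show ?thesis
    unfolding Mvf const_iff by - (rule exI[of _ ?H], rule exI[of _ ?K], simp)
qed

section \<open>The parallel Weihrauch lattice\<close>

lemma pw_degree_self: "f \<in> problems R \<Longrightarrow> f \<in> pw_degree R f"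
  by (simp add: pw_degree_def pw_le_refl)

lemma pw_lattice_le_iff:
  assumes "f \<in> problems R" and "g \<in> problems R"
  shows "pw_degree R f \<sqsubseteq>\<^bsub>pw_lattice R\<^esub> pw_degree R g \<longleftrightarrow> pw_le f g"
proof
  show "pw_le f g" if "pw_degree R f \<sqsubseteq>\<^bsub>pw_lattice R\<^esub> pw_degree R g"
    using that unfolding pw_lattice_def pw_degree_def by (auto intro: pw_le_trans)
  show "pw_degree R f \<sqsubseteq>\<^bsub>pw_lattice R\<^esub> pw_degree R g" if "pw_le f g"
    using that pw_degree_self[OF assms(1)] pw_degree_self[OF assms(2)]
    unfolding pw_lattice_def by auto
qed

lemma pw_lattice_carrierE:
  assumes "d \<in> carrier (pw_lattice R)"
  obtains h where "h \<in> problems R" "d = pw_degree R h"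
  using assms by (auto simp: pw_lattice_def problems_def)

lemma mvf_between_const:
  fixes R :: "'a rep_space set"
  assumes "admissible_spaces R"
  shows "mvf_between R (const_mvf p)"
proof -
  have "ran (baire_space :: 'a rep_space) = range Baire"
    by (auto simp: baire_space_def ran_def)
  moreover have "src (const_mvf p :: 'a mvf) = baire_space" "tgt (const_mvf p :: 'a mvf) = baire_space"
    "val (const_mvf p :: 'a mvf) x \<subseteq> range Baire" for x
    by (auto simp: const_mvf_def split: point.splits)
  ultimately show ?thesis
    using assms by (simp add: mvf_between_def admissible_spaces_def mvf_dom_const)
qed

lemma const_in_problems: "admissible_spaces R \<Longrightarrow> Mvf (const_mvf p) \<in> problems R"
  by (simp add: problems_def mvf_between_const)

lemma const_degree_in_carrier:
  assumes "admissible_spaces R"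
  shows "pw_degree R (Mvf (const_mvf p)) \<in> carrier (pw_lattice R)"
proof -
  have "computable_seq (\<lambda>n. 0)"
    unfolding computable_seq_def by (auto intro: computes.zero)
  then have "computable_point (src (const_mvf p)) (Baire (\<lambda>n. 0))"
    unfolding computable_point_def by (auto simp: const_mvf_def baire_space_def)
  moreover have "Baire (\<lambda>n. 0) \<in> mvf_dom (const_mvf p)"
    by (simp add: mvf_dom_const)
  ultimately show ?thesis
    using mvf_between_const[OF assms] by (force simp: pw_lattice_def)
qed

theorem corollary5p5:
  fixes R :: "'a rep_space set"
  assumes "admissible_spaces R"
  shows "\<exists>\<iota> \<in> carrier turing_degrees \<rightarrow> carrier (pw_lattice R).
    (\<forall>a\<in>carrier turing_degrees. \<forall>b\<in>carrier turing_degrees.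
      a \<sqsubseteq>\<^bsub>turing_degrees\<^esub> b \<longleftrightarrow> \<iota> a \<sqsubseteq>\<^bsub>pw_lattice R\<^esub> \<iota> b) \<and>
    (\<forall>a\<in>carrier turing_degrees. \<exists>f :: baire \<Rightarrow> baire.
      continuous_on UNIV f \<and> \<iota> a = pw_degree R (baire_fun f)) \<and>
    (\<forall>a\<in>carrier turing_degrees. \<forall>b\<in>carrier turing_degrees.
      (\<exists>c. is_lub turing_degrees c {a, b}) \<and>
      (\<forall>c. is_lub turing_degrees c {a, b} \<longrightarrow>
        is_lub (pw_lattice R) (\<iota> c) {\<iota> a, \<iota> b}))"
proof -
  define rep where "rep a = (SOME p. a = turing_equiv `` {p})" for a
  define \<iota> where "\<iota> a = pw_degree R (Mvf (const_mvf (rep a)))" for a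
  have rep: "a = turing_equiv `` {rep a}" if "a \<in> carrier turing_degrees" for a
  proof -
    obtain p where "a = turing_equiv `` {p}"
      using \<open>a \<in> carrier turing_degrees\<close> by (rule turing_degree_cases)
    then show ?thesis
      unfolding rep_def by (rule someI[where P = "\<lambda>p. a = turing_equiv `` {p}"])
  qed
  have le_rep: "a \<sqsubseteq>\<^bsub>turing_degrees\<^esub> b \<longleftrightarrow> turing_le (rep a) (rep b)"
    if "a \<in> carrier turing_degrees" "b \<in> carrier turing_degrees" for a b
    using turing_degree_le_iff[of "rep a" "rep b"] rep that by metis
  have le_const: "\<iota> a \<sqsubseteq>\<^bsub>pw_lattice R\<^esub> pw_degree R h \<longleftrightarrow> pw_le (Mvf (const_mvf (rep a))) h"
    if "h \<in> problems R" for a h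
    unfolding \<iota>_def by (rule pw_lattice_le_iff[OF const_in_problems[OF assms] that])
  have mono: "a \<sqsubseteq>\<^bsub>turing_degrees\<^esub> b \<longleftrightarrow> \<iota> a \<sqsubseteq>\<^bsub>pw_lattice R\<^esub> \<iota> b"
    if "a \<in> carrier turing_degrees" "b \<in> carrier turing_degrees" for a b
    unfolding \<iota>_def[of b] le_const[OF const_in_problems[OF assms]] pw_le_const_iff_turing_le
    using le_rep that by blast
  have carrier: "\<iota> a \<in> carrier (pw_lattice R)" for a
    unfolding \<iota>_def by (rule const_degree_in_carrier[OF assms])
  have lub: "is_lub (pw_lattice R) (\<iota> c) {\<iota> a, \<iota> b}"
    if ab: "a \<in> carrier turing_degrees" "b \<in> carrier turing_degrees"
      and c: "is_lub turing_degrees c {a, b}" for a b c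
  proof -
    have c': "c \<in> carrier turing_degrees" "a \<sqsubseteq>\<^bsub>turing_degrees\<^esub> c" "b \<sqsubseteq>\<^bsub>turing_degrees\<^esub> c"
      using c ab by (auto simp: is_lub_iff)
    have "c \<sqsubseteq>\<^bsub>turing_degrees\<^esub> turing_equiv `` {baire_pair (rep a) (rep b)}"
      using c ab is_lub_turing_degrees_pair[of "rep a" "rep b"]
      unfolding rep[OF ab(1), symmetric] rep[OF ab(2), symmetric] is_lub_iff by blast
    then have "turing_le (rep c) (baire_pair (rep a) (rep b))"
      using turing_degree_le_iff rep[OF c'(1)] by metis
    (* The embedding is defined through representatives, and rep c need not be the pair of
       rep a and rep b; being Turing reducible to that pair suffices for leastness. *)
    then have below: "pw_le (Mvf (const_mvf (rep c)) :: 'a problem)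
        (Mvf (const_mvf (baire_pair (rep a) (rep b))))"
      by (simp add: pw_le_const_iff_turing_le)
    have "\<iota> c \<sqsubseteq>\<^bsub>pw_lattice R\<^esub> d" if "d \<in> carrier (pw_lattice R)"
      "\<iota> a \<sqsubseteq>\<^bsub>pw_lattice R\<^esub> d" "\<iota> b \<sqsubseteq>\<^bsub>pw_lattice R\<^esub> d" for d
      using that(1)
    proof (rule pw_lattice_carrierE)
      fix h assume h: "h \<in> problems R" and d: "d = pw_degree R h"
      have "pw_le (Mvf (const_mvf (baire_pair (rep a) (rep b)))) h"
        using that(2,3) unfolding d le_const[OF h] by (rule pw_le_const_pair[OF h])
      with below show "\<iota> c \<sqsubseteq>\<^bsub>pw_lattice R\<^esub> d"
        unfolding d le_const[OF h] by (rule pw_le_trans)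
    qed
    then show ?thesis
      using mono ab c' carrier by (auto simp: is_lub_iff)
  qed
  show ?thesis
  proof (rule bexI[of _ \<iota>], intro conjI ballI allI impI)
    fix a b assume ab: "a \<in> carrier turing_degrees" "b \<in> carrier turing_degrees"
    show "a \<sqsubseteq>\<^bsub>turing_degrees\<^esub> b \<longleftrightarrow> \<iota> a \<sqsubseteq>\<^bsub>pw_lattice R\<^esub> \<iota> b"
      by (rule mono[OF ab])
    show "\<exists>c. is_lub turing_degrees c {a, b}"
      using is_lub_turing_degrees_pair rep ab by metis
    show "is_lub (pw_lattice R) (\<iota> c) {\<iota> a, \<iota> b}" if "is_lub turing_degrees c {a, b}" for c
      by (rule lub[OF ab that])
  next
    fix a assume "a \<in> carrier turing_degrees"
    show "\<exists>f :: baire \<Rightarrow> baire. continuous_on UNIV f \<and> \<iota> a = pw_degree R (baire_fun f)"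
      by (intro exI[of _ "\<lambda>_. rep a"]) (simp add: \<iota>_def baire_fun_const)
  next
    show "\<iota> \<in> carrier turing_degrees \<rightarrow> carrier (pw_lattice R)"
      by (simp add: carrier)
  qed
qed

end
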